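(* For real numbers $a,b>0$ with $a\neq b$, let $L(a,b)$ be the perimeter of the ellipse $\frac{x^2}{a^2}+\frac{y^2}{b^2}=1$, and define $\lambda=\frac{a-b}{a+b}$ and $h$ by $L(a,b)=\pi(a+b)(1+h)$. Then Ramanujan's approximation $$R(h)=4h-\frac{3h^{2}}{2+\sqrt{1-3h}}$$ to $\lambda^2$ asymptotically overestimates the true value $\lambda^2=\left(\frac{a-b}{a+b}\right)^2$ by $\frac{1}{32}h^6$ as $h\to 0^+$; that is, $$R(h)-\lambda^2\sim \frac{h^6}{32}\qquad (h\to 0^+).$$ Explicitly: for every $\varepsilon>0$ there is $\delta>0$ such that for all $a,b>0$ with $a\ne b$ and $0<h<\delta$, $$\left|\frac{R(h)-\left(\frac{a-b}{a+b}\right)^2}{h^6}-\frac1{32}\right|<\varepsilon .$$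
   Context: The perimeter $L(a,b)$ is the arc length $\int_0^{2\pi}\sqrt{a^2\sin^2 t+b^2\cos^2 t}\,dt$ of the ellipse with semiaxes $a,b$. The quantity $h=\frac{L(a,b)}{\pi(a+b)}-1$ depends only on $\lambda^2$, where $\lambda=\frac{a-b}{a+b}$; $h$ tends to $0$ exactly when $\lambda\to 0$. The square root is the nonnegative real one. *)

theory Defs
  imports "HOL-Analysis.Analysis"
begin

(* Arc length of the parametrised ellipse t |-> (a cos t, b sin t), 0 <= t <= 2 pi. *)
definition ellipse_perimeter :: "real \<Rightarrow> real \<Rightarrow> real" where
  "ellipse_perimeter a b =
     integral {0..2*pi} (\<lambda>t. sqrt (a\<^sup>2 * (sin t)\<^sup>2 + b\<^sup>2 * (cos t)\<^sup>2))"

(* The library's sqrt is odd, hence negative for h > 1/3; every ellipse has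
   h < 4/pi - 1 < 1/3, so here it is the usual nonnegative root. *)
definition ramanujan_approx :: "real \<Rightarrow> real" where
  "ramanujan_approx h = 4 * h - 3 * h\<^sup>2 / (2 + sqrt (1 - 3 * h))"

end

(* With x = ((a - b)/(a + b))^2, Parseval applied to the binomial series of
   sqrt (1 + r e^(2it)), r = (b - a)/(a + b), gives the Gauss-Kummer series
   1 + h = sum_n (1/2 choose n)^2 x^n.  Its coefficients lie in [0,1], so h is between
   its Taylor polynomial P of degree 6 and P + 2 x^7 once x <= 1/2.  Since R is
   increasing near 0, R(h) - x is squeezed between R(P) - x and R(P + 2 x^7) - x,
   both of which are x^6/2^17 + O(x^7), while h ~ x/4. *)
theory Submission
  imports Defs "HOL-Real_Asymp.Real_Asymp"
begin

section \<open>The Gauss-Kummer series of the perimeter\<close>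

lemma abs_gbinomial_half_le_1: "\<bar>(1/2::real) gchoose n\<bar> \<le> 1"
proof (induction n)
  case (Suc n)
  have "real (Suc n) * ((1/2) gchoose Suc n) = (1/2 - real n) * ((1/2) gchoose n)"
    using gbinomial_mult_1[of "1/2::real" n] by (simp add: algebra_simps)
  then have "real (Suc n) * \<bar>(1/2::real) gchoose Suc n\<bar> = \<bar>1/2 - real n\<bar> * \<bar>(1/2) gchoose n\<bar>"
    by (metis abs_mult abs_of_nat)
  \<comment> \<open>Consecutive coefficients have ratio |1/2 - n| / (n + 1), which is at most
    1.\<close>
  also have "\<dots> \<le> real (Suc n) * 1"
    by (intro mult_mono Suc.IH) auto
  finally show ?case by (simp del: of_nat_Suc)
qed simp

lemma norm_cis_sum_squared:
  fixes a :: "nat \<Rightarrow> real"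
  shows "(cmod (\<Sum>n<N. of_real (a n) * cis (real n * t)))\<^sup>2 =
    (\<Sum>m<N. \<Sum>n<N. a m * a n * cos ((real m - real n) * t))"
  unfolding cmod_power2
  by (simp add: power2_eq_square sum_product sum.distrib[symmetric] cos_diff algebra_simps)

text \<open>Orthogonality in the doubled angle: the ellipse integrand is a function of
  cos(2t).\<close>

lemma has_integral_cos_even_multiple:
  "((\<lambda>t. cos ((real m - real n) * (2 * t))) has_integral (if m = n then 2 * pi else 0)) {0..2*pi}"
proof (cases "m = n")
  case True
  then show ?thesis using has_integral_const_real[of "1::real" 0 "2*pi"] by simp
next
  case False
  define k where "k = 2 * (real m - real n)"
  have k: "k \<noteq> 0" using False by (simp add: k_def)
  have "((\<lambda>t. cos (k * t)) has_integral (sin (k * (2*pi)) / k - sin (k * 0) / k)) {0..2*pi}"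
    by (intro fundamental_theorem_of_calculus)
       (auto intro!: derivative_eq_intros simp: has_real_derivative_iff_has_vector_derivative[symmetric] k)
  moreover have "sin (k * (2*pi)) = 0"
    using sin_int_2pin[of "2 * (int m - int n)"] by (simp add: k_def mult_ac)
  ultimately show ?thesis using False by (simp add: k_def mult_ac)
qed

text \<open>Expanding the squared modulus gives a double sum of cosines, and orthogonality leaves
  its diagonal. Finite sums suffice here; the passage to the series is made later by dominated
  convergence.\<close>

lemma parseval_trig_polynomial:
  fixes a :: "nat \<Rightarrow> real"
  shows "((\<lambda>t. (cmod (\<Sum>n<N. of_real (a n) * cis (real n * (2 * t))))\<^sup>2)
    has_integral 2 * pi * (\<Sum>n<N. (a n)\<^sup>2)) {0..2*pi}"
proof -
  have "((\<lambda>t. \<Sum>m<N. \<Sum>n<N. a m * a n * cos ((real m - real n) * (2 * t)))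
      has_integral (\<Sum>m<N. \<Sum>n<N. a m * a n * (if m = n then 2 * pi else 0))) {0..2*pi}"
    by (intro has_integral_sum has_integral_mult_right has_integral_cos_even_multiple) auto
  moreover have "(\<Sum>m<N. \<Sum>n<N. a m * a n * (if m = n then 2 * pi else 0)) = 2 * pi * (\<Sum>n<N. (a n)\<^sup>2)"
    by (simp add: if_distrib sum_distrib_left power2_eq_square mult_ac cong: if_cong)
  ultimately show ?thesis
    by (simp only: norm_cis_sum_squared)
qed

text \<open>The link between arc length and Parseval: for z = r e^(it) the squared modulus of the
  principal root of 1 + z is |1 + z|, so the real root is a limit of squared moduli of trigonometric
  polynomials.\<close>

lemma norm_sqrt_binomial_partial_sums:
  fixes r t :: real
  assumes "\<bar>r\<bar> < 1"
  shows "(\<lambda>N. (cmod (\<Sum>n<N. of_real (((1/2) gchoose n) * r ^ n) * cis (real n * t)))\<^sup>2)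
    \<longlonglongrightarrow> sqrt (1 + r\<^sup>2 + 2 * r * cos t)"
proof -
  define z where "z = of_real r * cis t"
  have "cmod z < 1"
    using assms by (simp add: z_def norm_mult)
  then have "(\<lambda>n. ((1/2) gchoose n) * z ^ n) sums (1 + z) powr (1/2)"
    by (rule gen_binomial_complex)
  moreover have "((1/2) gchoose n) * z ^ n = of_real (((1/2) gchoose n) * r ^ n) * cis (real n * t)" for n
  proof -
    have "((1/2::complex) gchoose n) = of_real ((1/2) gchoose n)"
      by (simp add: gbinomial_prod_rev)
    then show ?thesis
      by (simp add: z_def power_mult_distrib Complex.DeMoivre)
  qed
  ultimately have "(\<lambda>N. (cmod (\<Sum>n<N. of_real (((1/2) gchoose n) * r ^ n) * cis (real n * t)))\<^sup>2)
      \<longlonglongrightarrow> (cmod ((1 + z) powr (1/2)))\<^sup>2"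
    unfolding sums_def by (intro tendsto_power tendsto_norm) simp
  moreover have "(cmod ((1 + z) powr (1/2)))\<^sup>2 = cmod (1 + z)"
  proof (cases "1 + z = 0")
    case False
    then have "(1 + z) powr (1/2) = csqrt (1 + z)"
      by (simp add: csqrt_conv_powr)
    then show ?thesis
      by (simp add: norm_power[symmetric])
  qed simp
  moreover have "(1 + r * cos t)\<^sup>2 + (r * sin t)\<^sup>2 = 1 + r\<^sup>2 + 2 * r * cos t"
  proof -
    have "(1 + r * C)\<^sup>2 + (r * S)\<^sup>2 = 1 + r\<^sup>2 * (S\<^sup>2 + C\<^sup>2) + 2 * r * C" for S C
      by (simp add: power2_eq_square algebra_simps)
    from this[of "cos t" "sin t"] show ?thesis by simp
  qed
  ultimately show ?thesis
    by (simp add: z_def cmod_def)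
qed

text \<open>Supplies the dominating constant, independent of N and t: coefficients bounded by 1
  leave a geometric series.\<close>

lemma norm_sqrt_binomial_partial_sum_le:
  fixes r t :: real
  assumes "\<bar>r\<bar> < 1"
  shows "cmod (\<Sum>n<N. of_real (((1/2) gchoose n) * r ^ n) * cis (real n * t)) \<le> 1 / (1 - \<bar>r\<bar>)"
proof -
  have "cmod (\<Sum>n<N. of_real (((1/2) gchoose n) * r ^ n) * cis (real n * t)) \<le> (\<Sum>n<N. \<bar>r\<bar> ^ n)"
  proof (rule sum_norm_le)
    fix n
    have "\<bar>(1/2::real) gchoose n\<bar> * \<bar>r\<bar> ^ n \<le> 1 * \<bar>r\<bar> ^ n"
      by (intro mult_right_mono abs_gbinomial_half_le_1) simp
    then show "cmod (of_real (((1/2) gchoose n) * r ^ n) * cis (real n * t)) \<le> \<bar>r\<bar> ^ n"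
      by (simp add: norm_mult norm_power abs_mult power_abs)
  qed
  also have "\<dots> \<le> (\<Sum>n. \<bar>r\<bar> ^ n)"
    using assms by (intro sum_le_suminf summable_geometric) auto
  also have "\<dots> = 1 / (1 - \<bar>r\<bar>)"
    using assms by (intro suminf_geometric) simp
  finally show ?thesis .
qed

theorem ellipse_perimeter_sums:
  assumes "a > 0" "b > 0"
  shows "(\<lambda>n. ((1/2) gchoose n)\<^sup>2 * (((a - b) / (a + b))\<^sup>2) ^ n) sums (ellipse_perimeter a b / (pi * (a + b)))"
proof -
  define s where "s = (a + b) / 2"
  \<comment> \<open>This sign gives a = s(1 - r) and b = s(1 + r), so the cosine term in the
    integrand is +2r cos(2t). The series sees only the square of \<open>r\<close>.\<close>
  define r where "r = (b - a) / (a + b)"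
  define f where "f = (\<lambda>N t. (cmod (\<Sum>n<N. of_real (((1/2) gchoose n) * r ^ n) * cis (real n * (2 * t))))\<^sup>2)"
  have s: "s > 0"
    using assms by (simp add: s_def)
  have r: "\<bar>r\<bar> < 1"
    using assms by (auto simp: r_def abs_if field_simps)
  have ab: "a = s * (1 - r)" "b = s * (1 + r)"
    using assms by (simp_all add: s_def r_def field_simps)
  have int: "(f N has_integral 2 * pi * (\<Sum>n<N. (((1/2) gchoose n) * r ^ n)\<^sup>2)) {0..2*pi}" for N
    unfolding f_def by (rule parseval_trig_polynomial)
  have "(\<lambda>N. integral {0..2*pi} (f N)) \<longlonglongrightarrow> integral {0..2*pi} (\<lambda>t. sqrt (1 + r\<^sup>2 + 2 * r * cos (2 * t)))"
  proof (rule dominated_convergence(2))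
    show "f N integrable_on {0..2*pi}" for N
      using int by blast
    show "(\<lambda>_. (1 / (1 - \<bar>r\<bar>))\<^sup>2) integrable_on {0..2*pi}"
      by (intro integrable_const_ivl)
    show "norm (f N t) \<le> (1 / (1 - \<bar>r\<bar>))\<^sup>2" for N t
      unfolding f_def using norm_sqrt_binomial_partial_sum_le[OF r] by (simp add: power_mono del: of_real_mult)
    show "(\<lambda>N. f N t) \<longlonglongrightarrow> sqrt (1 + r\<^sup>2 + 2 * r * cos (2 * t))" for t
      unfolding f_def by (rule norm_sqrt_binomial_partial_sums[OF r])
  qed
  moreover have "integral {0..2*pi} (\<lambda>t. sqrt (1 + r\<^sup>2 + 2 * r * cos (2 * t))) = ellipse_perimeter a b / s"
  proof -
    have "sqrt (a\<^sup>2 * (sin t)\<^sup>2 + b\<^sup>2 * (cos t)\<^sup>2) = s * sqrt (1 + r\<^sup>2 + 2 * r * cos (2 * t))" for t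
    proof -
      \<comment> \<open>A polynomial identity in free S and C; afterwards S + C becomes 1 and C - S
        becomes cos(2t).\<close>
      have "a\<^sup>2 * S + b\<^sup>2 * C = s\<^sup>2 * ((1 + r\<^sup>2) * (S + C) + 2 * r * (C - S))" for S C
        unfolding ab by (simp add: power2_eq_square algebra_simps)
      from this[of "(sin t)\<^sup>2" "(cos t)\<^sup>2"] show ?thesis
        using s by (simp add: cos_double real_sqrt_mult)
    qed
    then show ?thesis
      using s by (simp add: ellipse_perimeter_def)
  qed
  moreover have "integral {0..2*pi} (f N) = 2 * pi * (\<Sum>n<N. ((1/2) gchoose n)\<^sup>2 * (((a - b) / (a + b))\<^sup>2) ^ n)" for N
  proof -
    have "((a - b) / (a + b))\<^sup>2 = r\<^sup>2"
      by (simp add: r_def power_divide power2_commute)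
    then show ?thesis
      using integral_unique[OF int] by (simp add: power_mult_distrib power_mult[symmetric] mult.commute)
  qed
  \<comment> \<open>Since 2 pi s = pi (a + b), dividing by 2 pi yields the required
    normalisation.\<close>
  ultimately have "(\<lambda>N. 2 * pi * (\<Sum>n<N. ((1/2) gchoose n)\<^sup>2 * (((a - b) / (a + b))\<^sup>2) ^ n) / (2 * pi))
      \<longlonglongrightarrow> ellipse_perimeter a b / s / (2 * pi)"
    by (intro tendsto_divide) auto
  then show ?thesis
    by (simp add: sums_def s_def mult.commute)
qed

section \<open>Truncation of the Gauss-Kummer series after degree 6\<close>

definition perimeter_poly :: "real \<Rightarrow> real" where
  "perimeter_poly x = x/4 + x^2/64 + x^3/256 + 25*x^4/16384 + 49*x^5/65536 + 441*x^6/1048576"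

text \<open>All terms are nonnegative, so truncation gives a lower bound; squared coefficients at
  most 1 bound the tail by a geometric series starting at x^7. Degree 6 is the order at which R(h) -
  x first differs from 0, so an error of order x^7 is harmless.\<close>

lemma gbinomial_half_squared_sums_bounds:
  assumes S: "(\<lambda>n. ((1/2) gchoose n)\<^sup>2 * x ^ n) sums (1 + h)" and x: "0 \<le> x" "x < (1::real)"
  shows "perimeter_poly x \<le> h" and "h \<le> perimeter_poly x + x ^ 7 / (1 - x)"
proof -
  define T where "T = (\<Sum>n. ((1/2) gchoose (n + 7))\<^sup>2 * x ^ (n + 7))"
  have "(\<Sum>n<7. ((1/2) gchoose n)\<^sup>2 * x ^ n) = 1 + perimeter_poly x"
    by (simp add: perimeter_poly_def gbinomial_prod_rev eval_nat_numeral)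
  then have h: "h = perimeter_poly x + T"
    using suminf_split_initial_segment[OF sums_summable[OF S], of 7] sums_unique[OF S]
    by (simp add: T_def)
  have sm: "summable (\<lambda>n. ((1/2) gchoose (n + 7))\<^sup>2 * x ^ (n + 7))"
    using sums_summable[OF S] by (rule summable_ignore_initial_segment)
  have "T \<ge> 0"
    unfolding T_def using sm x by (intro suminf_nonneg) auto
  then show "perimeter_poly x \<le> h"
    by (simp add: h)
  have geo: "(\<lambda>n. x ^ 7 * x ^ n) sums (x ^ 7 * (1 / (1 - x)))"
    using x by (intro sums_mult geometric_sums) auto
  have "T \<le> (\<Sum>n. x ^ 7 * x ^ n)"
    unfolding T_def
  proof (rule suminf_le[OF _ sm sums_summable[OF geo]])
    fix n
    have "((1/2::real) gchoose (n + 7))\<^sup>2 \<le> 1"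
      using abs_gbinomial_half_le_1[of "n + 7"] by (simp add: abs_square_le_1)
    then have "((1/2) gchoose (n + 7))\<^sup>2 * x ^ (n + 7) \<le> 1 * x ^ (n + 7)"
      using x by (intro mult_right_mono) auto
    then show "((1/2) gchoose (n + 7))\<^sup>2 * x ^ (n + 7) \<le> x ^ 7 * x ^ n"
      by (simp add: power_add mult.commute)
  qed
  then show "h \<le> perimeter_poly x + x ^ 7 / (1 - x)"
    using sums_unique[OF geo] by (simp add: h)
qed

section \<open>Ramanujan's approximation near 0: monotonicity and limits\<close>

lemma ramanujan_approx_mono:
  assumes "0 \<le> u" "u \<le> v" "v \<le> 1/4"
  shows "ramanujan_approx u \<le> ramanujan_approx v"
proof -
  define p q where "p = sqrt (1 - 3 * u)" and "q = sqrt (1 - 3 * v)"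
  \<comment> \<open>The bound v \<le> 1/4 gives 1 - 3v \<ge> 1/4. Hence both roots are at least 1/2
    and p + q \<ge> 1.\<close>
  have q: "1/2 \<le> q"
    unfolding q_def using assms by (intro real_le_rsqrt) (simp add: power2_eq_square)
  have pq: "q \<le> p" "p \<le> 1"
    using assms by (simp_all add: p_def q_def)
  have squares: "p\<^sup>2 = 1 - 3 * u" "q\<^sup>2 = 1 - 3 * v"
    using assms by (simp_all add: p_def q_def)
  \<comment> \<open>The increment of h^2 / (2 + sqrt(1 - 3h)) splits into the change of the
    numerator and that of the denominator. Each is at most (v - u)/4, so three times their sum stays
    below the increment 4(v - u) of the linear term.\<close>
  have "v\<^sup>2 / (2 + q) - u\<^sup>2 / (2 + p) = (v\<^sup>2 - u\<^sup>2) / (2 + q) + u\<^sup>2 * (p - q) / ((2 + p) * (2 + q))"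
  proof -
    have "u\<^sup>2 / (2 + q) - u\<^sup>2 / (2 + p) = u\<^sup>2 * (p - q) / ((2 + p) * (2 + q))"
      using q pq by (simp add: diff_frac_eq algebra_simps)
    then show ?thesis by (simp add: diff_divide_distrib)
  qed
  moreover have "(v\<^sup>2 - u\<^sup>2) / (2 + q) \<le> (v - u) / 4"
  proof -
    have "v\<^sup>2 - u\<^sup>2 = (v - u) * (v + u)"
      by (simp add: power2_eq_square algebra_simps)
    also have "\<dots> \<le> (v - u) * (1/2)"
      using assms by (intro mult_left_mono) auto
    finally have "(v\<^sup>2 - u\<^sup>2) / (2 + q) \<le> (v - u) / 2 / 2"
      using q assms by (intro frac_le) auto
    then show ?thesis by simp
  qed
  moreover have "u\<^sup>2 * (p - q) / ((2 + p) * (2 + q)) \<le> (v - u) / 4"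
  proof -
    \<comment> \<open>Since p + q \<ge> 1, the difference of the roots is at most the difference of
      their squares.\<close>
    have "(p - q) * 1 \<le> (p - q) * (p + q)"
      using q pq by (intro mult_left_mono) auto
    also have "\<dots> = p\<^sup>2 - q\<^sup>2"
      by (simp add: power2_eq_square algebra_simps)
    also have "\<dots> = 3 * (v - u)"
      by (simp add: squares)
    finally have d: "p - q \<le> 3 * (v - u)" by simp
    have "u\<^sup>2 \<le> (1/4)\<^sup>2"
      using assms by (intro power_mono) auto
    then have "u\<^sup>2 * (p - q) \<le> (1/4)\<^sup>2 * (3 * (v - u))"
      using d pq by (intro mult_mono) auto
    moreover have "2 * 2 \<le> (2 + p) * (2 + q)"
      using q pq by (intro mult_mono) auto
    ultimately have "u\<^sup>2 * (p - q) / ((2 + p) * (2 + q)) \<le> (1/4)\<^sup>2 * (3 * (v - u)) / (2 * 2)"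
      using assms by (intro frac_le) auto
    also have "\<dots> \<le> (v - u) / 4"
      using assms by (simp add: power_divide)
    finally show ?thesis .
  qed
  ultimately have "v\<^sup>2 / (2 + q) - u\<^sup>2 / (2 + p) \<le> (v - u) / 4 + (v - u) / 4"
    by (simp only: add_mono)
  also have "\<dots> \<le> 4 * (v - u) / 3"
    using assms by simp
  finally have "(v\<^sup>2 / (2 + q) - u\<^sup>2 / (2 + p)) * 3 \<le> 4 * (v - u)"
    by (simp only: pos_le_divide_eq zero_less_numeral)
  then show ?thesis
    by (simp add: ramanujan_approx_def p_def q_def left_diff_distrib mult.commute[of _ 3])
qed

text \<open>The numerator is x^6/2^17 + O(x^7) and the denominator x^6/2^12 + O(x^7). The smaller
  argument is paired with the larger denominator to bound the quotient at h from below; the next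
  limit reverses the pairing for the upper bound.\<close>

lemma ramanujan_approx_lower_limit:
  "((\<lambda>x. (ramanujan_approx (perimeter_poly x) - x) / (perimeter_poly x + 2 * x ^ 7) ^ 6) \<longlongrightarrow> 1/32) (at_right 0)"
  unfolding ramanujan_approx_def perimeter_poly_def by (real_asymp simp: power_divide)

lemma ramanujan_approx_upper_limit:
  "((\<lambda>x. (ramanujan_approx (perimeter_poly x + 2 * x ^ 7) - x) / perimeter_poly x ^ 6) \<longlongrightarrow> 1/32) (at_right 0)"
  unfolding ramanujan_approx_def perimeter_poly_def by (real_asymp simp: power_divide)

text \<open>Positive numerators are what make the quotients comparable when their denominators
  differ.\<close>

lemma ramanujan_approx_poly_overestimates:
  "eventually (\<lambda>x. ramanujan_approx (perimeter_poly x) > x) (at_right 0)"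
  unfolding ramanujan_approx_def perimeter_poly_def by (real_asymp simp: power_divide)

section \<open>The squeeze\<close>

theorem theorem2:
  "\<forall>\<epsilon>::real. \<epsilon> > 0 \<longrightarrow> (\<exists>\<delta>::real. \<delta> > 0 \<and>
     (\<forall>a b h :: real. a > 0 \<longrightarrow> b > 0 \<longrightarrow> a \<noteq> b \<longrightarrow>
        ellipse_perimeter a b = pi * (a + b) * (1 + h) \<longrightarrow> 0 < h \<longrightarrow> h < \<delta> \<longrightarrow>
        \<bar>(ramanujan_approx h - ((a - b) / (a + b))\<^sup>2) / h ^ 6 - 1 / 32\<bar> < \<epsilon>))"
proof (intro allI impI)
  fix \<epsilon> :: real
  assume \<epsilon>: "\<epsilon> > 0"
  define P Q where "P = perimeter_poly" and "Q = (\<lambda>x. perimeter_poly x + 2 * x ^ 7)"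
  have "eventually (\<lambda>x. \<bar>(ramanujan_approx (P x) - x) / Q x ^ 6 - 1/32\<bar> < \<epsilon>) (at_right 0)"
    using tendstoD[OF ramanujan_approx_lower_limit \<epsilon>] by (simp add: P_def Q_def dist_real_def)
  moreover have "eventually (\<lambda>x. \<bar>(ramanujan_approx (Q x) - x) / P x ^ 6 - 1/32\<bar> < \<epsilon>) (at_right 0)"
    using tendstoD[OF ramanujan_approx_upper_limit \<epsilon>] by (simp add: P_def Q_def dist_real_def)
  moreover have "eventually (\<lambda>x. ramanujan_approx (P x) > x) (at_right 0)"
    unfolding P_def by (rule ramanujan_approx_poly_overestimates)
  \<comment> \<open>Keeps all arguments in the range where \<open>ramanujan_approx\<close> is known
    to be monotone.\<close>
  moreover have "eventually (\<lambda>x. Q x \<le> 1/4) (at_right 0)"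
    unfolding Q_def perimeter_poly_def by real_asymp
  moreover have "eventually (\<lambda>x::real. x \<le> 1/2) (at_right 0)"
    by real_asymp
  ultimately have "eventually (\<lambda>x. \<bar>(ramanujan_approx (P x) - x) / Q x ^ 6 - 1/32\<bar> < \<epsilon> \<and>
      \<bar>(ramanujan_approx (Q x) - x) / P x ^ 6 - 1/32\<bar> < \<epsilon> \<and>
      ramanujan_approx (P x) > x \<and> Q x \<le> 1/4 \<and> x \<le> 1/2) (at_right 0)"
    by (intro eventually_conj)
  then obtain x0 where x0: "x0 > 0"
    and small: "\<And>x. 0 < x \<Longrightarrow> x < x0 \<Longrightarrow> \<bar>(ramanujan_approx (P x) - x) / Q x ^ 6 - 1/32\<bar> < \<epsilon> \<and>
      \<bar>(ramanujan_approx (Q x) - x) / P x ^ 6 - 1/32\<bar> < \<epsilon> \<and>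
      ramanujan_approx (P x) > x \<and> Q x \<le> 1/4 \<and> x \<le> 1/2"
    unfolding eventually_at_right_field by auto
  show "\<exists>\<delta>>0. \<forall>a b h. a > 0 \<longrightarrow> b > 0 \<longrightarrow> a \<noteq> b \<longrightarrow>
        ellipse_perimeter a b = pi * (a + b) * (1 + h) \<longrightarrow> 0 < h \<longrightarrow> h < \<delta> \<longrightarrow>
        \<bar>(ramanujan_approx h - ((a - b) / (a + b))\<^sup>2) / h ^ 6 - 1 / 32\<bar> < \<epsilon>"
  proof (intro exI conjI allI impI)
    \<comment> \<open>The witness x0/4 turns smallness of h into smallness of x: x/4 \<le> P x \<le>
      h < x0/4 gives x < x0.\<close>
    show "x0 / 4 > 0" using x0 by simp
    fix a b h :: real
    assume ab: "a > 0" "b > 0" "a \<noteq> b" and L: "ellipse_perimeter a b = pi * (a + b) * (1 + h)"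
      and h: "0 < h" "h < x0 / 4"
    define x where "x = ((a - b) / (a + b))\<^sup>2"
    have x: "0 < x" "x < 1"
    proof -
      show "0 < x" using ab by (simp add: x_def)
      have "\<bar>(a - b) / (a + b)\<bar> < 1"
        using ab by (auto simp: abs_if field_simps)
      then show "x < 1" by (simp add: x_def abs_square_less_1)
    qed
    have "(\<lambda>n. ((1/2) gchoose n)\<^sup>2 * x ^ n) sums (1 + h)"
      using ellipse_perimeter_sums[of a b] ab L by (simp add: x_def)
    note bounds = gbinomial_half_squared_sums_bounds[OF this less_imp_le[OF x(1)] x(2)]
    have Ph: "P x \<le> h" using bounds(1) by (simp add: P_def)
    have "x / 4 \<le> P x"
      using x by (simp add: P_def perimeter_poly_def)
    then have P: "0 < P x" and "x < x0"
      using Ph h x by simp_all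
    note small = small[OF x(1) this(2)]
    \<comment> \<open>From x \<le> 1/2 comes 1/(1 - x) \<le> 2, the source of the factor 2 in
      \<open>Q\<close>.\<close>
    have "x ^ 7 * 1 \<le> x ^ 7 * (2 * (1 - x))"
      using x small by (intro mult_left_mono) auto
    then have "x ^ 7 / (1 - x) \<le> 2 * x ^ 7"
      using x by (simp add: field_simps)
    then have hQ: "h \<le> Q x"
      using bounds(2) by (simp add: Q_def)
    have lower: "ramanujan_approx (P x) \<le> ramanujan_approx h"
      using P Ph hQ small by (intro ramanujan_approx_mono) auto
    have upper: "ramanujan_approx h \<le> ramanujan_approx (Q x)"
      using h hQ small by (intro ramanujan_approx_mono) auto
    \<comment> \<open>P x \<le> h \<le> Q x orders numerators and denominators; R(P x) > x makes all
      numerators positive, so the quotient at h lies between the two controlled ones.\<close>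
    have "(ramanujan_approx (P x) - x) / Q x ^ 6 \<le> (ramanujan_approx h - x) / h ^ 6"
      using lower small h hQ by (intro frac_le power_mono) auto
    moreover have "(ramanujan_approx h - x) / h ^ 6 \<le> (ramanujan_approx (Q x) - x) / P x ^ 6"
      using lower upper small P Ph by (intro frac_le power_mono) auto
    ultimately have "\<bar>(ramanujan_approx h - x) / h ^ 6 - 1 / 32\<bar> < \<epsilon>"
      using small by linarith
    then show "\<bar>(ramanujan_approx h - ((a - b) / (a + b))\<^sup>2) / h ^ 6 - 1 / 32\<bar> < \<epsilon>"
      by (simp add: x_def)
  qed
qed

end
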